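(* Let $\mathcal{S}(\mathbb{R}_+)$ be the Schwartz space on the positive reals and let $d_{\mathcal{S}(\mathbb{R}_+)}$ be the metric $$d_{\mathcal{S}(\mathbb{R}_+)}(f,g) := \sum_{\alpha\in\mathbb{Z},\ \beta\in\mathbb{N}_0} \frac{2^{-(|\alpha|+|\beta|)}\,p_{\alpha,\beta}(f-g)}{1+p_{\alpha,\beta}(f-g)}.$$ Then $(\mathcal{S}(\mathbb{R}_+), d_{\mathcal{S}(\mathbb{R}_+)})$ is a complete metric space.
   Context: $\mathbb{R}_+=(0,\infty)$, $\mathbb{N}_0=\{0,1,2,\ldots\}$. $\mathcal{S}(\mathbb{R}_+)$ is the real vector space of all $f\in C^\infty(\mathbb{R}_+)$ (real-valued) such that for all $\alpha\in\mathbb{Z}$ and $\beta\in\mathbb{N}_0$ one has $p_{\alpha,\beta}(f) := \sup_{x\in\mathbb{R}_+} |x^\alpha f^{(\beta)}(x)| < \infty$. *)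

theory Defs
  imports "HOL-Analysis.Analysis"
begin

text \<open>
  Functions on the open half-line are represented by functions on the reals that are
  extensional on it (equal to \<^const>\<open>undefined\<close> elsewhere), so that equality is equality of
  functions on the half-line. Since the half-line is open, the iterated derivatives
  at its points do not depend on the values outside.
\<close>

definition smooth_Rpos :: "(real \<Rightarrow> real) set" where
  "smooth_Rpos = {f \<in> extensional {0<..}. \<forall>n. (deriv ^^ n) f differentiable_on {0<..}}"

definition schwartz_Rpos :: "(real \<Rightarrow> real) set" where
  "schwartz_Rpos = {f \<in> smooth_Rpos.
     \<forall>(\<alpha>::int) (\<beta>::nat). bdd_above ((\<lambda>x. \<bar>x powi \<alpha> * (deriv ^^ \<beta>) f x\<bar>) ` {0<..})}"

definition schwartz_seminorm :: "int \<Rightarrow> nat \<Rightarrow> (real \<Rightarrow> real) \<Rightarrow> real" where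
  "schwartz_seminorm \<alpha> \<beta> f = (SUP x\<in>{0<..}. \<bar>x powi \<alpha> * (deriv ^^ \<beta>) f x\<bar>)"

definition schwartz_diff :: "(real \<Rightarrow> real) \<Rightarrow> (real \<Rightarrow> real) \<Rightarrow> real \<Rightarrow> real" where
  "schwartz_diff f g = (\<lambda>x\<in>{0<..}. f x - g x)"

text \<open>
  The distance is set to 0 outside the Schwartz space because the locale \<^locale>\<open>Metric_space\<close> requires nonnegativity and symmetry on the whole type.
\<close>

definition schwartz_dist :: "(real \<Rightarrow> real) \<Rightarrow> (real \<Rightarrow> real) \<Rightarrow> real" where
  "schwartz_dist f g =
     (if f \<in> schwartz_Rpos \<and> g \<in> schwartz_Rpos
      then \<Sum>\<^sub>\<infinity>(\<alpha>, \<beta>)\<in>UNIV. 2 powi (- (\<bar>\<alpha>\<bar> + int \<beta>)) * schwartz_seminorm \<alpha> \<beta> (schwartz_diff f g)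
                             / (1 + schwartz_seminorm \<alpha> \<beta> (schwartz_diff f g))
      else 0)"

text \<open>
  The distance is well defined: differences of Schwartz functions are Schwartz functions, so
  the suprema are finite, and the series converges.
\<close>

lemma deriv_funpow_diff:
  assumes "f \<in> smooth_Rpos" "g \<in> smooth_Rpos" "x > 0"
  shows "(deriv ^^ n) (schwartz_diff f g) x = (deriv ^^ n) f x - (deriv ^^ n) g x"
  using \<open>x > 0\<close>
proof (induction n arbitrary: x)
  case 0
  then show ?case by (simp add: schwartz_diff_def)
next
  case (Suc n)
  have df: "(deriv ^^ n) h field_differentiable at x" if "h \<in> smooth_Rpos" for h
    using that Suc.prems
    by (auto simp: smooth_Rpos_def differentiable_on_eq_differentiable_at field_differentiable_def
        real_differentiable_def)
  have "eventually (\<lambda>y. y \<in> {0<..}) (nhds x)"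
    using Suc.prems by (intro eventually_nhds_in_open) auto
  then have "\<forall>\<^sub>F y in nhds x. (deriv ^^ n) (schwartz_diff f g) y
                 = (deriv ^^ n) f y - (deriv ^^ n) g y"
    by eventually_elim (use Suc.IH in auto)
  then have "deriv ((deriv ^^ n) (schwartz_diff f g)) x
               = deriv (\<lambda>y. (deriv ^^ n) f y - (deriv ^^ n) g y) x"
    by (rule deriv_cong_ev) simp
  also have "\<dots> = deriv ((deriv ^^ n) f) x - deriv ((deriv ^^ n) g) x"
    using df assms by (intro deriv_diff) auto
  finally show ?case by simp
qed

lemma schwartz_diff_in:
  assumes "f \<in> schwartz_Rpos" "g \<in> schwartz_Rpos"
  shows "schwartz_diff f g \<in> schwartz_Rpos"
proof -
  have s: "f \<in> smooth_Rpos" "g \<in> smooth_Rpos"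
    using assms by (auto simp: schwartz_Rpos_def)
  note eq = deriv_funpow_diff[OF s]
  have "(deriv ^^ n) (schwartz_diff f g) differentiable_on {0<..}" for n
  proof -
    have *: "(\<lambda>x. (deriv ^^ n) f x - (deriv ^^ n) g x) differentiable_on {0<..}"
      using s by (intro differentiable_on_diff) (auto simp: smooth_Rpos_def)
    show ?thesis
      unfolding differentiable_on_def
    proof
      fix x :: real assume x: "x \<in> {0<..}"
      show "(deriv ^^ n) (schwartz_diff f g) differentiable at x within {0<..}"
        by (rule differentiable_transform_within[OF _ zero_less_one x])
           (use * x in \<open>auto simp: differentiable_on_def eq\<close>)
    qed
  qed
  then have "schwartz_diff f g \<in> smooth_Rpos"
    by (auto simp: smooth_Rpos_def schwartz_diff_def)
  moreover have "bdd_above ((\<lambda>x. \<bar>x powi \<alpha> * (deriv ^^ \<beta>) (schwartz_diff f g) x\<bar>) ` {0<..})" for \<alpha> \<beta>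
  proof -
    obtain A where A: "\<And>x. x > 0 \<Longrightarrow> \<bar>x powi \<alpha> * (deriv ^^ \<beta>) f x\<bar> \<le> A"
      using assms(1) by (fastforce simp: schwartz_Rpos_def bdd_above_def)
    obtain B where B: "\<And>x. x > 0 \<Longrightarrow> \<bar>x powi \<alpha> * (deriv ^^ \<beta>) g x\<bar> \<le> B"
      using assms(2) by (fastforce simp: schwartz_Rpos_def bdd_above_def)
    have "\<bar>x powi \<alpha> * (deriv ^^ \<beta>) (schwartz_diff f g) x\<bar> \<le> A + B" if "x > 0" for x
      using A[OF that] B[OF that] by (simp only: eq[OF that] right_diff_distrib)
    then show ?thesis
      by (intro bdd_aboveI[of _ "A + B"]) auto
  qed
  ultimately show ?thesis
    by (auto simp: schwartz_Rpos_def)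
qed

lemma schwartz_seminorm_nonneg:
  assumes "f \<in> schwartz_Rpos"
  shows "schwartz_seminorm \<alpha> \<beta> f \<ge> 0"
  unfolding schwartz_seminorm_def
  by (rule cSUP_upper2[where x = 1]) (use assms in \<open>auto simp: schwartz_Rpos_def\<close>)

lemma summable_on_half_powi_nat: "(\<lambda>n::nat. (2::real) powi (- int n)) summable_on UNIV"
proof -
  have "(\<lambda>n::nat. (1/2::real) ^ n) summable_on UNIV"
    by (intro norm_summable_imp_summable_on) (simp add: power_abs summable_geometric)
  moreover have "(2::real) powi (- int n) = (1/2) ^ n" for n
    by (simp add: power_int_minus power_one_over inverse_eq_divide)
  ultimately show ?thesis by simp
qed

lemma summable_on_half_powi_abs: "(\<lambda>k::int. (2::real) powi (- \<bar>k\<bar>)) summable_on UNIV"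
proof -
  let ?w = "\<lambda>k::int. (2::real) powi (- \<bar>k\<bar>)"
  have "?w summable_on range int"
    by (subst summable_on_reindex) (simp_all add: o_def summable_on_half_powi_nat)
  moreover have "?w summable_on range (\<lambda>n. - int n)"
    by (subst summable_on_reindex) (simp_all add: o_def inj_def summable_on_half_powi_nat)
  ultimately have "?w summable_on range int \<union> range (\<lambda>n. - int n)"
    by (rule summable_on_union)
  moreover have "k \<in> range int \<union> range (\<lambda>n. - int n)" for k
    by (cases k rule: int_cases2) auto
  then have "range int \<union> range (\<lambda>n. - int n) = UNIV"
    by blast
  ultimately show ?thesis by simp
qed

lemma schwartz_dist_summable:
  assumes "f \<in> schwartz_Rpos" "g \<in> schwartz_Rpos"
  shows "(\<lambda>(\<alpha>, \<beta>). 2 powi (- (\<bar>\<alpha>\<bar> + int \<beta>)) * schwartz_seminorm \<alpha> \<beta> (schwartz_diff f g)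
           / (1 + schwartz_seminorm \<alpha> \<beta> (schwartz_diff f g))) summable_on UNIV"
proof -
  have g: "(\<lambda>n::nat. (2::real) powi (- int n)) summable_on UNIV"
    by (rule summable_on_half_powi_nat)
  have "(\<lambda>(\<alpha>::int, \<beta>::nat). (2::real) powi (- (\<bar>\<alpha>\<bar> + int \<beta>))) summable_on UNIV \<times> UNIV"
  proof (rule summable_on_SigmaI)
    fix \<alpha> :: int
    show "((\<lambda>\<beta>::nat. case (\<alpha>, \<beta>) of (\<alpha>, \<beta>) \<Rightarrow> (2::real) powi (- (\<bar>\<alpha>\<bar> + int \<beta>)))
            has_sum 2 powi (- \<bar>\<alpha>\<bar>) * (\<Sum>\<^sub>\<infinity>n::nat. 2 powi (- int n))) UNIV"
      using has_sum_cmult_right[OF has_sum_infsum[OF g], of "2 powi (- \<bar>\<alpha>\<bar>)"]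
      by (simp add: power_int_add[symmetric])
  next
    show "(\<lambda>\<alpha>::int. 2 powi (- \<bar>\<alpha>\<bar>) * (\<Sum>\<^sub>\<infinity>n::nat. 2 powi (- int n) :: real)) summable_on UNIV"
      by (intro summable_on_cmult_left summable_on_half_powi_abs)
  qed auto
  then have s: "(\<lambda>(\<alpha>::int, \<beta>::nat). (2::real) powi (- (\<bar>\<alpha>\<bar> + int \<beta>))) summable_on UNIV"
    by simp
  show ?thesis
  proof (rule summable_on_comparison_test[OF s])
    fix ab :: "int \<times> nat"
    obtain a b where ab: "ab = (a, b)" by (cases ab)
    define p where "p = schwartz_seminorm a b (schwartz_diff f g)"
    have "p \<ge> 0"
      unfolding p_def by (intro schwartz_seminorm_nonneg schwartz_diff_in assms)
    then have q: "0 \<le> p / (1 + p)" "p / (1 + p) \<le> 1" by (auto simp: field_simps)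
    have w: "(2::real) powi (- (\<bar>a\<bar> + int b)) \<ge> 0" by simp
    show "(case ab of (\<alpha>, \<beta>) \<Rightarrow> 2 powi (- (\<bar>\<alpha>\<bar> + int \<beta>)) * schwartz_seminorm \<alpha> \<beta> (schwartz_diff f g)
           / (1 + schwartz_seminorm \<alpha> \<beta> (schwartz_diff f g)))
        \<le> (case ab of (\<alpha>, \<beta>) \<Rightarrow> 2 powi (- (\<bar>\<alpha>\<bar> + int \<beta>)))"
      using mult_left_mono[OF q(2) w] by (simp add: ab p_def)
    show "0 \<le> (case ab of (\<alpha>, \<beta>) \<Rightarrow> 2 powi (- (\<bar>\<alpha>\<bar> + int \<beta>)) * schwartz_seminorm \<alpha> \<beta> (schwartz_diff f g)
           / (1 + schwartz_seminorm \<alpha> \<beta> (schwartz_diff f g)))"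
      using mult_nonneg_nonneg[OF w q(1)] by (simp add: ab p_def)
  qed
qed

end

theory Submission
  imports Defs
begin

text \<open>
  The function \<open>t / (1 + t)\<close> is increasing, subadditive and bounded by 1 on the nonnegative reals.
  Subadditivity turns each seminorm into a pseudometric, the bound makes the weighted
  series of these pseudometrics converge, and the single seminorm with \<open>\<alpha> = \<beta> = 0\<close> already
  separates points.

  For completeness, the distance is compared with the seminorms in both directions. A
  small distance makes each fixed seminorm small, because each summand is at most the whole sum
  (lemma \<open>schwartz_seminorm_less_if_dist_less\<close>). Conversely, if every seminorm of \<open>f\<^sub>n - F\<close> tends to 0, then so
  does the distance, by dominated convergence with the summable weights as majorant
  (lemma \<open>schwartz_dist_tendsto_0\<close>). It remains to find a limit for a sequence that is
  Cauchy in every seminorm (lemma \<open>schwartz_limit_exists\<close>). The seminorms with \<open>\<alpha> = 0\<close> make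
  all derivatives converge uniformly on the half-line, so limit and derivative may be
  exchanged and the pointwise limit is smooth. Letting one of the two indices of
  the Cauchy condition tend to infinity at each point \<open>x\<close> bounds every seminorm of \<open>f\<^sub>n - F\<close>; this
  gives at once that \<open>F\<close> decays and that \<open>f\<^sub>n\<close> converges to \<open>F\<close>.
\<close>

section \<open>The seminorms\<close>

lemma schwartz_imp_smooth: "f \<in> schwartz_Rpos \<Longrightarrow> f \<in> smooth_Rpos"
  by (simp add: schwartz_Rpos_def)

lemma schwartz_seminorm_upper:
  assumes "f \<in> schwartz_Rpos" "x > 0"
  shows "\<bar>x powi \<alpha> * (deriv ^^ \<beta>) f x\<bar> \<le> schwartz_seminorm \<alpha> \<beta> f"
  unfolding schwartz_seminorm_def
  by (rule cSUP_upper) (use assms in \<open>auto simp: schwartz_Rpos_def\<close>)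

lemma schwartz_seminorm_least:
  assumes "\<And>x. x > 0 \<Longrightarrow> \<bar>x powi \<alpha> * (deriv ^^ \<beta>) f x\<bar> \<le> M"
  shows "schwartz_seminorm \<alpha> \<beta> f \<le> M"
  unfolding schwartz_seminorm_def by (rule cSUP_least) (use assms in auto)

lemma schwartz_seminorm_diff_upper:
  assumes "f \<in> schwartz_Rpos" "g \<in> schwartz_Rpos" "x > 0"
  shows "\<bar>x powi \<alpha> * ((deriv ^^ \<beta>) f x - (deriv ^^ \<beta>) g x)\<bar>
           \<le> schwartz_seminorm \<alpha> \<beta> (schwartz_diff f g)"
  using schwartz_seminorm_upper[OF schwartz_diff_in[OF assms(1,2)] assms(3), of \<alpha> \<beta>] assms
  by (simp add: deriv_funpow_diff schwartz_imp_smooth)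

lemma schwartz_seminorm_diff_least:
  assumes "f \<in> smooth_Rpos" "g \<in> smooth_Rpos"
    and "\<And>x. x > 0 \<Longrightarrow> \<bar>x powi \<alpha> * ((deriv ^^ \<beta>) f x - (deriv ^^ \<beta>) g x)\<bar> \<le> M"
  shows "schwartz_seminorm \<alpha> \<beta> (schwartz_diff f g) \<le> M"
  by (rule schwartz_seminorm_least) (use assms in \<open>simp add: deriv_funpow_diff\<close>)

lemma schwartz_seminorm_diff_nonneg:
  assumes "f \<in> schwartz_Rpos" "g \<in> schwartz_Rpos"
  shows "0 \<le> schwartz_seminorm \<alpha> \<beta> (schwartz_diff f g)"
  using assms by (intro schwartz_seminorm_nonneg schwartz_diff_in)

lemma schwartz_seminorm_diff_triangle:
  assumes "f \<in> schwartz_Rpos" "g \<in> schwartz_Rpos" "h \<in> schwartz_Rpos"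
  shows "schwartz_seminorm \<alpha> \<beta> (schwartz_diff f h)
           \<le> schwartz_seminorm \<alpha> \<beta> (schwartz_diff f g) + schwartz_seminorm \<alpha> \<beta> (schwartz_diff g h)"
proof (rule schwartz_seminorm_diff_least)
  fix x :: real assume x: "x > 0"
  let ?D = "\<lambda>f. (deriv ^^ \<beta>) f x"
  have "x powi \<alpha> * (?D f - ?D h) = x powi \<alpha> * (?D f - ?D g) + x powi \<alpha> * (?D g - ?D h)"
    by (simp add: algebra_simps)
  then show "\<bar>x powi \<alpha> * (?D f - ?D h)\<bar>
        \<le> schwartz_seminorm \<alpha> \<beta> (schwartz_diff f g) + schwartz_seminorm \<alpha> \<beta> (schwartz_diff g h)"
    using schwartz_seminorm_diff_upper[OF assms(1,2) x, of \<alpha> \<beta>]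
      schwartz_seminorm_diff_upper[OF assms(2,3) x, of \<alpha> \<beta>] by linarith
qed (use assms in \<open>auto intro: schwartz_imp_smooth\<close>)

lemma schwartz_seminorm_diff_commute:
  assumes "f \<in> schwartz_Rpos" "g \<in> schwartz_Rpos"
  shows "schwartz_seminorm \<alpha> \<beta> (schwartz_diff f g) = schwartz_seminorm \<alpha> \<beta> (schwartz_diff g f)"
  unfolding schwartz_seminorm_def
  by (rule SUP_cong)
    (use assms in \<open>auto simp: deriv_funpow_diff schwartz_imp_smooth abs_mult abs_minus_commute\<close>)

lemma schwartz_seminorm_diff_self:
  assumes "f \<in> schwartz_Rpos"
  shows "schwartz_seminorm \<alpha> \<beta> (schwartz_diff f f) = 0"
  using schwartz_seminorm_diff_least[of f f \<alpha> \<beta> 0] schwartz_seminorm_diff_nonneg[of f f \<alpha> \<beta>] assms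
  by (simp add: schwartz_imp_smooth)

lemma schwartz_eqI:
  assumes f: "f \<in> schwartz_Rpos" and g: "g \<in> schwartz_Rpos"
    and zero: "schwartz_seminorm 0 0 (schwartz_diff f g) = 0"
  shows "f = g"
proof (rule extensionalityI)
  show "f \<in> extensional {0<..}" "g \<in> extensional {0<..}"
    using f g by (auto simp: schwartz_Rpos_def smooth_Rpos_def)
  show "f x = g x" if "x \<in> {0<..}" for x
    using schwartz_seminorm_diff_upper[OF f g, of x 0 0] that zero by simp
qed

section \<open>The metric\<close>

text \<open>
  Monotonicity and subadditivity of \<open>t / (1 + t)\<close> in one step: the numerators may be split
  over the common denominator \<open>1 + a + b\<close>, and shrinking it to \<open>1 + a\<close> or \<open>1 + b\<close> only enlarges the fractions.
\<close>

lemma ratio_one_plus_le_add: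
  fixes a b c :: real
  assumes "0 \<le> a" "0 \<le> b" "0 \<le> c" "c \<le> a + b"
  shows "c / (1 + c) \<le> a / (1 + a) + b / (1 + b)"
proof -
  have "c / (1 + c) \<le> (a + b) / (1 + (a + b))"
    using assms by (simp add: divide_simps) (simp add: algebra_simps)
  also have "\<dots> = a / (1 + (a + b)) + b / (1 + (a + b))"
    by (simp add: add_divide_distrib)
  also have "\<dots> \<le> a / (1 + a) + b / (1 + b)"
    using assms by (intro add_mono divide_left_mono) auto
  finally show ?thesis .
qed

definition schwartz_weight :: "int \<times> nat \<Rightarrow> real" where
  "schwartz_weight = (\<lambda>(\<alpha>, \<beta>). 2 powi (- (\<bar>\<alpha>\<bar> + int \<beta>)))"

definition schwartz_dist_term :: "(real \<Rightarrow> real) \<Rightarrow> (real \<Rightarrow> real) \<Rightarrow> int \<times> nat \<Rightarrow> real" where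
  "schwartz_dist_term f g = (\<lambda>(\<alpha>, \<beta>). 2 powi (- (\<bar>\<alpha>\<bar> + int \<beta>)) * schwartz_seminorm \<alpha> \<beta> (schwartz_diff f g)
                             / (1 + schwartz_seminorm \<alpha> \<beta> (schwartz_diff f g)))"

lemma schwartz_dist_term_eq:
  "schwartz_dist_term f g (\<alpha>, \<beta>) = schwartz_weight (\<alpha>, \<beta>) *
     (schwartz_seminorm \<alpha> \<beta> (schwartz_diff f g) / (1 + schwartz_seminorm \<alpha> \<beta> (schwartz_diff f g)))"
  by (simp add: schwartz_dist_term_def schwartz_weight_def)

lemma schwartz_weight_pos: "0 < schwartz_weight i"
  by (cases i) (simp add: schwartz_weight_def)

lemma schwartz_weight_summable: "schwartz_weight summable_on UNIV"
proof -
  have "schwartz_weight summable_on UNIV \<times> UNIV"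
  proof (rule summable_on_SigmaI)
    fix \<alpha> :: int
    show "((\<lambda>\<beta>. schwartz_weight (\<alpha>, \<beta>)) has_sum 2 powi (- \<bar>\<alpha>\<bar>) * (\<Sum>\<^sub>\<infinity>n::nat. 2 powi (- int n))) UNIV"
      using has_sum_cmult_right[OF has_sum_infsum[OF summable_on_half_powi_nat], of "2 powi (- \<bar>\<alpha>\<bar>)"]
      by (simp add: schwartz_weight_def power_int_add[symmetric])
    show "(\<lambda>\<alpha>::int. 2 powi (- \<bar>\<alpha>\<bar>) * (\<Sum>\<^sub>\<infinity>n::nat. 2 powi (- int n) :: real)) summable_on UNIV"
      by (intro summable_on_cmult_left summable_on_half_powi_abs)
  qed (simp add: schwartz_weight_pos less_imp_le)
  then show ?thesis by simp
qed

lemma schwartz_dist_eq_infsum: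
  assumes "f \<in> schwartz_Rpos" "g \<in> schwartz_Rpos"
  shows "schwartz_dist f g = infsum (schwartz_dist_term f g) UNIV"
  using assms by (simp add: schwartz_dist_def schwartz_dist_term_def)

lemma schwartz_dist_term_summable:
  assumes "f \<in> schwartz_Rpos" "g \<in> schwartz_Rpos"
  shows "schwartz_dist_term f g summable_on UNIV"
  using schwartz_dist_summable[OF assms] by (simp add: schwartz_dist_term_def)

lemma schwartz_dist_term_bounds:
  assumes "f \<in> schwartz_Rpos" "g \<in> schwartz_Rpos"
  shows "0 \<le> schwartz_dist_term f g i" "schwartz_dist_term f g i \<le> schwartz_weight i"
proof -
  obtain \<alpha> \<beta> where i: "i = (\<alpha>, \<beta>)" by (cases i)
  define p where "p = schwartz_seminorm \<alpha> \<beta> (schwartz_diff f g)"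
  have "0 \<le> p"
    unfolding p_def using assms by (rule schwartz_seminorm_diff_nonneg)
  then have "0 \<le> p / (1 + p)" "p / (1 + p) \<le> 1"
    by auto
  moreover have "schwartz_dist_term f g i = schwartz_weight i * (p / (1 + p))"
    by (simp only: i schwartz_dist_term_eq p_def)
  moreover have "0 \<le> schwartz_weight i"
    using schwartz_weight_pos[of i] by simp
  ultimately show "0 \<le> schwartz_dist_term f g i" "schwartz_dist_term f g i \<le> schwartz_weight i"
    by (simp_all only: mult_nonneg_nonneg mult_right_le_one_le)
qed

lemma schwartz_dist_term_le_dist:
  assumes "f \<in> schwartz_Rpos" "g \<in> schwartz_Rpos"
  shows "schwartz_dist_term f g i \<le> schwartz_dist f g"
  using finite_sum_le_infsum[OF schwartz_dist_term_summable[OF assms], of "{i}"]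
  by (simp add: schwartz_dist_eq_infsum schwartz_dist_term_bounds assms)

theorem schwartz_metric_space: "Metric_space schwartz_Rpos schwartz_dist"
proof
  fix f g
  show "0 \<le> schwartz_dist f g"
  proof (cases "f \<in> schwartz_Rpos \<and> g \<in> schwartz_Rpos")
    case True
    then show ?thesis
      by (simp add: schwartz_dist_eq_infsum infsum_nonneg schwartz_dist_term_bounds)
  qed (auto simp: schwartz_dist_def)
  show "schwartz_dist f g = schwartz_dist g f"
    by (auto simp: schwartz_dist_def schwartz_seminorm_diff_commute)
next
  fix f g assume fg: "f \<in> schwartz_Rpos" "g \<in> schwartz_Rpos"
  show "schwartz_dist f g = 0 \<longleftrightarrow> f = g"
  proof
    assume "schwartz_dist f g = 0"
    then have "schwartz_dist_term f g (0, 0) = 0"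
      using schwartz_dist_term_le_dist[OF fg, of "(0, 0)"] schwartz_dist_term_bounds(1)[OF fg, of "(0, 0)"]
      by simp
    then have "schwartz_seminorm 0 0 (schwartz_diff f g) = 0"
      using schwartz_seminorm_diff_nonneg[OF fg, of 0 0] by (simp add: schwartz_dist_term_def)
    then show "f = g"
      by (rule schwartz_eqI[OF fg])
  next
    assume "f = g"
    then show "schwartz_dist f g = 0"
      using fg by (simp add: schwartz_dist_def schwartz_seminorm_diff_self case_prod_unfold)
  qed
next
  fix f g h assume S: "f \<in> schwartz_Rpos" "g \<in> schwartz_Rpos" "h \<in> schwartz_Rpos"
  have "schwartz_dist_term f h i \<le> schwartz_dist_term f g i + schwartz_dist_term g h i" for i
  proof -
    obtain \<alpha> \<beta> where i: "i = (\<alpha>, \<beta>)" by (cases i)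
    show ?thesis
      unfolding i schwartz_dist_term_eq distrib_left[symmetric]
      using S schwartz_weight_pos[of "(\<alpha>, \<beta>)"]
      by (intro mult_left_mono ratio_one_plus_le_add schwartz_seminorm_diff_nonneg
          schwartz_seminorm_diff_triangle) auto
  qed
  then have "infsum (schwartz_dist_term f h) UNIV
               \<le> infsum (\<lambda>i. schwartz_dist_term f g i + schwartz_dist_term g h i) UNIV"
    using S by (intro infsum_mono summable_on_add schwartz_dist_term_summable) auto
  also have "\<dots> = infsum (schwartz_dist_term f g) UNIV + infsum (schwartz_dist_term g h) UNIV"
    using S by (intro infsum_add schwartz_dist_term_summable) auto
  finally show "schwartz_dist f h \<le> schwartz_dist f g + schwartz_dist g h"
    using S by (simp add: schwartz_dist_eq_infsum)
qed

section \<open>Comparing the metric with the seminorms\<close>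

text \<open>
  The threshold is the value of the summand at \<open>(\<alpha>, \<beta>)\<close> for a seminorm equal to \<open>\<epsilon>\<close>; since
  \<open>t / (1 + t)\<close> is increasing, a summand below it forces the seminorm below \<open>\<epsilon>\<close>.
\<close>

lemma schwartz_seminorm_less_if_dist_less:
  assumes "f \<in> schwartz_Rpos" "g \<in> schwartz_Rpos" "\<epsilon> > 0"
    and "schwartz_dist f g < schwartz_weight (\<alpha>, \<beta>) * (\<epsilon> / (1 + \<epsilon>))"
  shows "schwartz_seminorm \<alpha> \<beta> (schwartz_diff f g) < \<epsilon>"
proof -
  define p where "p = schwartz_seminorm \<alpha> \<beta> (schwartz_diff f g)"
  have "schwartz_weight (\<alpha>, \<beta>) * (p / (1 + p)) < schwartz_weight (\<alpha>, \<beta>) * (\<epsilon> / (1 + \<epsilon>))"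
    using schwartz_dist_term_le_dist[OF assms(1,2), of "(\<alpha>, \<beta>)"] assms(4)
    unfolding schwartz_dist_term_eq p_def by linarith
  then have "p / (1 + p) < \<epsilon> / (1 + \<epsilon>)"
    using schwartz_weight_pos[of "(\<alpha>, \<beta>)"] mult_less_cancel_left_pos by blast
  moreover have "0 \<le> p"
    unfolding p_def using assms(1,2) by (rule schwartz_seminorm_diff_nonneg)
  ultimately have "p < \<epsilon>"
    using assms(3) by (simp add: divide_simps) (simp add: algebra_simps)
  then show ?thesis by (simp add: p_def)
qed

text \<open>
  This is dominated convergence to 0 for unordered sums: outside a finite set the majorant contributes little
  uniformly in \<open>n\<close>, and on that finite set the terms tend to 0.
\<close>

lemma tendsto_infsum_0_dominated:
  fixes u :: "nat \<Rightarrow> 'a \<Rightarrow> real"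
  assumes w: "w summable_on A"
    and bounds: "\<And>n i. i \<in> A \<Longrightarrow> 0 \<le> u n i" "\<And>n i. i \<in> A \<Longrightarrow> u n i \<le> w i"
    and lim: "\<And>i. i \<in> A \<Longrightarrow> (\<lambda>n. u n i) \<longlonglongrightarrow> 0"
  shows "(\<lambda>n. infsum (u n) A) \<longlonglongrightarrow> 0"
proof (rule tendstoI)
  fix \<epsilon> :: real assume \<epsilon>: "\<epsilon> > 0"
  have u: "u n summable_on A" for n
    by (rule summable_on_comparison_test[OF w]) (use bounds in auto)
  obtain F where F: "finite F" "F \<subseteq> A" "dist (sum w F) (infsum w A) \<le> \<epsilon> / 2"
    using infsum_finite_approximation[OF w, of "\<epsilon> / 2"] \<epsilon> by auto
  have split: "infsum v A = sum v F + infsum v (A - F)" if "v summable_on A" for v :: "'a \<Rightarrow> real"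
  proof -
    have "infsum v (F \<union> (A - F)) = infsum v F + infsum v (A - F)"
      using F that by (intro infsum_Un_disjoint) (auto intro: summable_on_subset)
    then show ?thesis
      using F by (simp add: Un_absorb1)
  qed
  have tail: "infsum (u n) (A - F) \<le> \<epsilon> / 2" for n
  proof -
    have "infsum (u n) (A - F) \<le> infsum w (A - F)"
      by (intro infsum_mono summable_on_subset[OF u] summable_on_subset[OF w]) (use bounds in auto)
    also have "\<dots> \<le> \<epsilon> / 2"
      using split[OF w] F(3) by (simp add: dist_real_def)
    finally show ?thesis .
  qed
  have "(\<lambda>n. sum (u n) F) \<longlonglongrightarrow> (\<Sum>i\<in>F. 0)"
    using F(2) by (intro tendsto_sum lim) auto
  then have "\<forall>\<^sub>F n in sequentially. sum (u n) F < \<epsilon> / 2"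
    using \<epsilon> by (intro order_tendstoD(2)) auto
  then show "\<forall>\<^sub>F n in sequentially. dist (infsum (u n) A) 0 < \<epsilon>"
  proof eventually_elim
    case (elim n)
    have "0 \<le> infsum (u n) A"
      using bounds by (intro infsum_nonneg)
    then show ?case
      using elim tail[of n] split[OF u, of n] by simp
  qed
qed

lemma schwartz_dist_tendsto_0:
  assumes \<sigma>: "\<And>n. \<sigma> n \<in> schwartz_Rpos" and F: "F \<in> schwartz_Rpos"
    and lim: "\<And>\<alpha> \<beta>. (\<lambda>n. schwartz_seminorm \<alpha> \<beta> (schwartz_diff (\<sigma> n) F)) \<longlonglongrightarrow> 0"
  shows "(\<lambda>n. schwartz_dist (\<sigma> n) F) \<longlonglongrightarrow> 0"
proof -
  have "(\<lambda>n. infsum (schwartz_dist_term (\<sigma> n) F) UNIV) \<longlonglongrightarrow> 0"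
  proof (rule tendsto_infsum_0_dominated[OF schwartz_weight_summable])
    fix i :: "int \<times> nat"
    obtain \<alpha> \<beta> where i: "i = (\<alpha>, \<beta>)" by (cases i)
    have "(\<lambda>n. schwartz_dist_term (\<sigma> n) F i) \<longlonglongrightarrow> schwartz_weight (\<alpha>, \<beta>) * (0 / (1 + 0))"
      unfolding i schwartz_dist_term_eq by (intro tendsto_intros lim) auto
    then show "(\<lambda>n. schwartz_dist_term (\<sigma> n) F i) \<longlonglongrightarrow> 0"
      by simp
  qed (use schwartz_dist_term_bounds \<sigma> F in auto)
  then show ?thesis
    using \<sigma> F by (simp add: schwartz_dist_eq_infsum)
qed

section \<open>Limits of Cauchy sequences\<close>

lemma deriv_funpow_has_derivative:
  assumes "f \<in> smooth_Rpos" "x > 0"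
  shows "((deriv ^^ n) f has_real_derivative (deriv ^^ Suc n) f x) (at x)"
proof -
  have "(deriv ^^ n) f differentiable at x"
    using assms by (auto simp: smooth_Rpos_def differentiable_on_eq_differentiable_at)
  then show ?thesis
    using DERIV_deriv_iff_real_differentiable by simp
qed

text \<open>
  The iterated derivatives of the restriction agree with the \<open>G n\<close> only on the half-line; because the
  half-line is open, this is enough to differentiate once more, and the induction goes through.
\<close>

lemma deriv_chain_imp_smooth:
  fixes G :: "nat \<Rightarrow> real \<Rightarrow> real"
  assumes G: "\<And>n x. x > 0 \<Longrightarrow> (G n has_real_derivative G (Suc n) x) (at x)"
  shows "x > 0 \<Longrightarrow> (deriv ^^ n) (restrict (G 0) {0<..}) x = G n x"
    and "restrict (G 0) {0<..} \<in> smooth_Rpos"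
proof -
  define F where "F = restrict (G 0) {0<..}"
  have deriv_step: "((deriv ^^ n) F has_real_derivative G (Suc n) x) (at x)"
    if "\<forall>x>0. (deriv ^^ n) F x = G n x" "x > 0" for n x
    by (rule has_field_derivative_transform_within_open[OF G[of x n], of "{0<..}"]) (use that in auto)
  have chain: "\<forall>x>0. (deriv ^^ n) F x = G n x" for n
  proof (induction n)
    case 0
    then show ?case by (simp add: F_def)
  next
    case (Suc n)
    then show ?case
      using deriv_step[of n] by (simp add: DERIV_imp_deriv)
  qed
  then show "(deriv ^^ n) (restrict (G 0) {0<..}) x = G n x" if "x > 0" for n x
    using that by (simp add: F_def)
  have "((deriv ^^ n) F has_real_derivative G (Suc n) x) (at x)" if "x > 0" for n x
    using chain that by (rule deriv_step)
  then have "(deriv ^^ n) F differentiable_on {0<..}" for n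
    by (auto simp: differentiable_on_eq_differentiable_at real_differentiable_def)
  then show "restrict (G 0) {0<..} \<in> smooth_Rpos"
    by (auto simp: smooth_Rpos_def F_def)
qed

text \<open>
  The limit is built from the pointwise limits \<open>G \<beta>\<close> of the \<open>\<beta>\<close>-th derivatives, all defined at once.
  Uniform convergence of the next derivatives, together with convergence at the single point 1,
  gives \<open>G (\<beta> + 1)\<close> as derivative of \<open>G \<beta>\<close>. Decay of the limit follows from decay of one \<open>\<sigma> N\<close> that is within
  seminorm distance 1 of it.
\<close>

lemma schwartz_limit_exists:
  assumes \<sigma>: "\<And>n. \<sigma> n \<in> schwartz_Rpos"
    and cauchy: "\<And>\<alpha> \<beta> \<epsilon>. \<epsilon> > 0 \<Longrightarrow>
      \<exists>N. \<forall>m\<ge>N. \<forall>n\<ge>N. schwartz_seminorm \<alpha> \<beta> (schwartz_diff (\<sigma> m) (\<sigma> n)) < \<epsilon>"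
  obtains F where "F \<in> schwartz_Rpos"
    "\<And>\<alpha> \<beta>. (\<lambda>n. schwartz_seminorm \<alpha> \<beta> (schwartz_diff (\<sigma> n) F)) \<longlonglongrightarrow> 0"
proof -
  define D where "D \<beta> n = (deriv ^^ \<beta>) (\<sigma> n)" for \<beta> n
  have smooth: "\<sigma> n \<in> smooth_Rpos" for n
    using \<sigma> by (rule schwartz_imp_smooth)
  have D_cauchy: "\<exists>N. \<forall>m\<ge>N. \<forall>n\<ge>N. \<forall>x>0. \<bar>x powi \<alpha> * (D \<beta> m x - D \<beta> n x)\<bar> < \<epsilon>"
    if "\<epsilon> > 0" for \<alpha> \<beta> \<epsilon>
    using cauchy[OF that, of \<alpha> \<beta>] schwartz_seminorm_diff_upper[OF \<sigma> \<sigma>]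
    unfolding D_def by (meson order_le_less_trans)

  define G where "G \<beta> x = lim (\<lambda>n. D \<beta> n x)" for \<beta> x
  have D_lim: "(\<lambda>n. D \<beta> n x) \<longlonglongrightarrow> G \<beta> x" if "x > 0" for \<beta> x
  proof -
    have "Cauchy (\<lambda>n. D \<beta> n x)"
    proof (rule CauchyI)
      fix \<epsilon> :: real assume "\<epsilon> > 0"
      then show "\<exists>N. \<forall>m\<ge>N. \<forall>n\<ge>N. norm (D \<beta> m x - D \<beta> n x) < \<epsilon>"
        using D_cauchy[of \<epsilon> 0 \<beta>] that by auto
    qed
    then show ?thesis
      unfolding G_def by (simp add: Cauchy_convergent convergent_LIMSEQ_iff[symmetric])
  qed
  \<comment> \<open>The Cauchy bound is uniform in \<open>x\<close>, so it survives \<open>n \<longlonglongrightarrow> \<infinity>\<close> at every point.\<close>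
  have D_unif: "\<exists>N. \<forall>m\<ge>N. \<forall>x>0. \<bar>x powi \<alpha> * (D \<beta> m x - G \<beta> x)\<bar> \<le> \<epsilon>" if \<epsilon>: "\<epsilon> > 0" for \<alpha> \<beta> \<epsilon>
  proof -
    obtain N where N: "\<And>m n x. m \<ge> N \<Longrightarrow> n \<ge> N \<Longrightarrow> x > 0 \<Longrightarrow> \<bar>x powi \<alpha> * (D \<beta> m x - D \<beta> n x)\<bar> < \<epsilon>"
      using D_cauchy[OF \<epsilon>, of \<alpha> \<beta>] by blast
    have "\<bar>x powi \<alpha> * (D \<beta> m x - G \<beta> x)\<bar> \<le> \<epsilon>" if "m \<ge> N" "x > 0" for m x
    proof (rule tendsto_upperbound)
      show "(\<lambda>n. \<bar>x powi \<alpha> * (D \<beta> m x - D \<beta> n x)\<bar>) \<longlonglongrightarrow> \<bar>x powi \<alpha> * (D \<beta> m x - G \<beta> x)\<bar>"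
        using that by (intro tendsto_intros D_lim)
      show "\<forall>\<^sub>F n in sequentially. \<bar>x powi \<alpha> * (D \<beta> m x - D \<beta> n x)\<bar> \<le> \<epsilon>"
        using eventually_ge_at_top[of N] by eventually_elim (use N that in \<open>auto intro: less_imp_le\<close>)
    qed simp
    then show ?thesis by blast
  qed

  have G_deriv: "(G \<beta> has_real_derivative G (Suc \<beta>) x) (at x)" if x: "x > 0" for \<beta> x
  proof -
    have "\<exists>g. \<forall>x\<in>{0<..}. (\<lambda>n. D \<beta> n x) \<longlonglongrightarrow> g x \<and>
            (g has_derivative (\<lambda>h. G (Suc \<beta>) x * h)) (at x within {0<..})"
    proof (rule has_derivative_sequence)
      show "(D \<beta> n has_derivative (\<lambda>h. D (Suc \<beta>) n x * h)) (at x within {0<..})"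
        if "x \<in> {0<..}" for n x
        using deriv_funpow_has_derivative[OF smooth, of x \<beta> n] that
        unfolding D_def has_field_derivative_def by (auto intro: has_derivative_at_withinI)
      show "\<forall>\<^sub>F n in sequentially. \<forall>x\<in>{0<..}. \<forall>h. norm (D (Suc \<beta>) n x * h - G (Suc \<beta>) x * h) \<le> e * norm h"
        if e: "e > 0" for e
      proof -
        obtain N where N: "\<And>m x. m \<ge> N \<Longrightarrow> x > 0 \<Longrightarrow> \<bar>D (Suc \<beta>) m x - G (Suc \<beta>) x\<bar> \<le> e"
          using D_unif[OF e, of 0 "Suc \<beta>"] by auto
        show ?thesis
          using eventually_ge_at_top[of N]
        proof eventually_elim
          case (elim n)
          show ?case
            unfolding left_diff_distrib[symmetric] norm_mult
            by (intro ballI allI mult_right_mono) (use N elim in auto)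
        qed
      qed
      show "(\<lambda>n. D \<beta> n 1) \<longlonglongrightarrow> G \<beta> 1" by (rule D_lim) simp
    qed auto
    then obtain g where g: "\<And>x. x > 0 \<Longrightarrow> (\<lambda>n. D \<beta> n x) \<longlonglongrightarrow> g x"
      "\<And>x. x > 0 \<Longrightarrow> (g has_derivative (\<lambda>h. G (Suc \<beta>) x * h)) (at x within {0<..})"
      by auto
    have "g y = G \<beta> y" if "y > 0" for y
      using LIMSEQ_unique[OF g(1)[OF that] D_lim[OF that]] .
    moreover have "(g has_real_derivative G (Suc \<beta>) x) (at x)"
      using g(2)[OF x] x by (simp add: has_field_derivative_def at_within_open[of x "{0<..}"])
    ultimately show ?thesis
      using x by (auto intro: has_field_derivative_transform_within_open[of g _ x "{0<..}"])
  qed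

  define F where "F = restrict (G 0) {0<..}"
  have F_deriv: "(deriv ^^ \<beta>) F x = G \<beta> x" if "x > 0" for \<beta> x
    unfolding F_def using G_deriv that by (rule deriv_chain_imp_smooth(1))
  have F_smooth: "F \<in> smooth_Rpos"
    unfolding F_def using G_deriv by (rule deriv_chain_imp_smooth(2))
  have F_schwartz: "F \<in> schwartz_Rpos"
  proof -
    have "bdd_above ((\<lambda>x. \<bar>x powi \<alpha> * (deriv ^^ \<beta>) F x\<bar>) ` {0<..})" for \<alpha> \<beta>
    proof -
      obtain N where N: "\<And>x. x > 0 \<Longrightarrow> \<bar>x powi \<alpha> * (D \<beta> N x - G \<beta> x)\<bar> \<le> 1"
        using D_unif[of 1 \<alpha> \<beta>] by auto
      have "\<bar>x powi \<alpha> * (deriv ^^ \<beta>) F x\<bar> \<le> schwartz_seminorm \<alpha> \<beta> (\<sigma> N) + 1" if x: "x > 0" for x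
      proof -
        have "x powi \<alpha> * G \<beta> x = x powi \<alpha> * D \<beta> N x - x powi \<alpha> * (D \<beta> N x - G \<beta> x)"
          by (simp add: algebra_simps)
        moreover have "\<bar>x powi \<alpha> * D \<beta> N x\<bar> \<le> schwartz_seminorm \<alpha> \<beta> (\<sigma> N)"
          unfolding D_def using \<sigma> x by (rule schwartz_seminorm_upper)
        ultimately show ?thesis
          unfolding F_deriv[OF x] using N[OF x] by linarith
      qed
      then show ?thesis
        by (intro bdd_aboveI[of _ "schwartz_seminorm \<alpha> \<beta> (\<sigma> N) + 1"]) auto
    qed
    then show ?thesis
      using F_smooth by (simp add: schwartz_Rpos_def)
  qed
  have "(\<lambda>n. schwartz_seminorm \<alpha> \<beta> (schwartz_diff (\<sigma> n) F)) \<longlonglongrightarrow> 0" for \<alpha> \<beta>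
  proof (rule LIMSEQ_I)
    fix \<epsilon> :: real assume \<epsilon>: "\<epsilon> > 0"
    obtain N where N: "\<And>n x. n \<ge> N \<Longrightarrow> x > 0 \<Longrightarrow> \<bar>x powi \<alpha> * (D \<beta> n x - G \<beta> x)\<bar> \<le> \<epsilon> / 2"
      using D_unif[of "\<epsilon> / 2" \<alpha> \<beta>] \<epsilon> by auto
    have "norm (schwartz_seminorm \<alpha> \<beta> (schwartz_diff (\<sigma> n) F) - 0) < \<epsilon>" if "n \<ge> N" for n
    proof -
      have "schwartz_seminorm \<alpha> \<beta> (schwartz_diff (\<sigma> n) F) \<le> \<epsilon> / 2"
        by (rule schwartz_seminorm_diff_least[OF smooth F_smooth])
          (use N[OF that] in \<open>simp add: F_deriv D_def\<close>)
      then show ?thesis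
        using \<epsilon> schwartz_seminorm_diff_nonneg[OF \<sigma> F_schwartz, of \<alpha> \<beta> n] by simp
    qed
    then show "\<exists>N. \<forall>n\<ge>N. norm (schwartz_seminorm \<alpha> \<beta> (schwartz_diff (\<sigma> n) F) - 0) < \<epsilon>"
      by blast
  qed
  with F_schwartz show ?thesis by (rule that)
qed

section \<open>Completeness\<close>

theorem theorem3:
  "Metric_space schwartz_Rpos schwartz_dist \<and> Metric_space.mcomplete schwartz_Rpos schwartz_dist"
proof
  show "Metric_space schwartz_Rpos schwartz_dist"
    by (rule schwartz_metric_space)
  interpret Metric_space schwartz_Rpos schwartz_dist
    by (rule schwartz_metric_space)
  show mcomplete
    unfolding mcomplete_def
  proof (intro allI impI)
    fix \<sigma> assume "MCauchy \<sigma>"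
    then have \<sigma>: "\<sigma> n \<in> schwartz_Rpos"
      and cauchy: "\<delta> > 0 \<Longrightarrow> \<exists>N. \<forall>m n. N \<le> m \<longrightarrow> N \<le> n \<longrightarrow> schwartz_dist (\<sigma> m) (\<sigma> n) < \<delta>" for n \<delta>
      by (auto simp: MCauchy_def)
    have "\<exists>N. \<forall>m\<ge>N. \<forall>n\<ge>N. schwartz_seminorm \<alpha> \<beta> (schwartz_diff (\<sigma> m) (\<sigma> n)) < \<epsilon>"
      if "\<epsilon> > 0" for \<alpha> \<beta> \<epsilon>
    proof -
      have "0 < schwartz_weight (\<alpha>, \<beta>) * (\<epsilon> / (1 + \<epsilon>))"
        using that schwartz_weight_pos by simp
      then show ?thesis
        using cauchy schwartz_seminorm_less_if_dist_less[OF \<sigma> \<sigma> that] by meson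
    qed
    then obtain F where F: "F \<in> schwartz_Rpos"
      "\<And>\<alpha> \<beta>. (\<lambda>n. schwartz_seminorm \<alpha> \<beta> (schwartz_diff (\<sigma> n) F)) \<longlonglongrightarrow> 0"
      using schwartz_limit_exists[of \<sigma>] \<sigma> by metis
    have "(\<lambda>n. schwartz_dist (\<sigma> n) F) \<longlonglongrightarrow> 0"
      using \<sigma> F by (rule schwartz_dist_tendsto_0)
    then have "limitin mtopology \<sigma> F sequentially"
      using \<sigma> F(1) by (simp add: limitin_metric tendsto_iff)
    then show "\<exists>F. limitin mtopology \<sigma> F sequentially"
      by (rule exI[where x = F])
  qed
qed

end
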